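(* Let $\{y_t\}_{t\in\mathbb{Z}}$ be a process satisfying the TV-ARMA($p,q$) equation $y_t=\varphi(t)+\sum_{m=1}^{p}\phi_m(t)y_{t-m}+u_t$, $u_t=\varepsilon_t+\sum_{l=1}^{q}\theta_l(t)\varepsilon_{t-l}$, for all $t\in\mathbb{Z}$. Then an equivalent explicit representation of $y_t$ in terms of the prescribed random variables $\{y_r\}_{s+1-p\le r\le s}$, for any $s\in\mathbb{Z}$ and any integer $t\ge s+1-p$ such that $s<t$, is $$y_t=\sum_{m=1}^{p}\xi^{(m)}(t,s)\,y_{s+1-m}+\sum_{r=s+1}^{t}\xi(t,r)\varphi(r)+\sum_{r=s+1}^{t}\xi_q(t,r)\varepsilon_r+\sum_{r=s+1-q}^{s}\xi_{s,q}(t,r)\varepsilon_r .$$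
   Context: Let $p,q\ge 1$ be integers and $(\Omega,\mathcal F,P)$ a probability space. The autoregressive coefficients $\phi_m(t)$ and moving average coefficients $\theta_l(t)$ ($t\in\mathbb{Z}$) are either deterministic (real-valued functions of $t$) or stochastic (random variables); the drift $\varphi(t)$ is likewise deterministic or stochastic. The errors satisfy $\mathbb{E}(\varepsilon_t)=0$, $\mathbb{E}(\varepsilon_t\varepsilon_s)=0$ for $s\ne t$, $\mathbb{E}(\varepsilon_t\mid y_s,s<t)=0$, $\mathbb{E}(\varepsilon_t^2)=\sigma^2(t)$ with $0<\sigma^2(t)\le M<\infty$ for all $t$ and some $M$. Principal determinant: for integers $s<t$, $\xi(t,s)=\det(\mathbf{\Phi}_{t,s})$, where $\mathbf{\Phi}_{t,s}$ is the $(t-s)\times(t-s)$ banded lower Hessenberg matrix whose $(i,j)$ entry is $\phi_{i-j+1}(s+i)$ if $0\le i-j\le p-1$, $-1$ if $j=i+1$, and $0$ otherwise. Moreover $\xi(t,t)=1$ and $\xi(t,s)=0$ for $t<s$. For $1\le m\le p$: $\xi^{(m)}(t,s)=\sum_{r=1}^{p+1-m}\phi_{m-1+r}(s+r)\,\xi(t,s+r)$. Also $\xi_q(t,r)=\xi(t,r)+\sum_{l=1}^{q}\xi(t,r+l)\theta_l(r+l)$ and $\xi_{s,q}(t,r)=\sum_{l=s+1-r}^{q}\xi(t,r+l)\theta_l(r+l)$ (empty sums are zero). *)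

theory Defs
  imports "HOL-Probability.Probability" "Jordan_Normal_Form.Determinant"
begin

text \<open>
  Coefficients, drift, errors and the process are all families of real functions on the sample
  space. A deterministic quantity is the special case of a function not depending on the sample
  point \<open>\<omega>\<close>; for stochastic coefficients the determinants are taken pointwise in \<open>\<omega>\<close>.
\<close>

text \<open>
  Matrix indices start at 0 here, so row \<open>i\<close> is row \<open>i + 1\<close> of the usual 1-based description
  and its coefficients are evaluated at time \<open>s + i + 1\<close>; the lag \<open>i - j + 1\<close> is unaffected.
\<close>

definition Phi_mat ::
  "nat \<Rightarrow> (nat \<Rightarrow> int \<Rightarrow> 'a \<Rightarrow> real) \<Rightarrow> int \<Rightarrow> int \<Rightarrow> 'a \<Rightarrow> real mat" where
  "Phi_mat p \<phi> t s \<omega> = Matrix.mat (nat (t - s)) (nat (t - s)) (\<lambda>(i, j).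
     if j \<le> i \<and> i - j \<le> p - 1 then \<phi> (i - j + 1) (s + int i + 1) \<omega>
     else if j = i + 1 then - 1
     else 0)"

definition xi ::
  "nat \<Rightarrow> (nat \<Rightarrow> int \<Rightarrow> 'a \<Rightarrow> real) \<Rightarrow> int \<Rightarrow> int \<Rightarrow> 'a \<Rightarrow> real" where
  "xi p \<phi> t s \<omega> =
     (if s < t then Determinant.det (Phi_mat p \<phi> t s \<omega>) else if t = s then 1 else 0)"

definition xi_sup ::
  "nat \<Rightarrow> (nat \<Rightarrow> int \<Rightarrow> 'a \<Rightarrow> real) \<Rightarrow> nat \<Rightarrow> int \<Rightarrow> int \<Rightarrow> 'a \<Rightarrow> real" where
  "xi_sup p \<phi> m t s \<omega> =
     (\<Sum>r = 1..p + 1 - m. \<phi> (m - 1 + r) (s + int r) \<omega> * xi p \<phi> t (s + int r) \<omega>)"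

definition xi_q ::
  "nat \<Rightarrow> (nat \<Rightarrow> int \<Rightarrow> 'a \<Rightarrow> real) \<Rightarrow> nat \<Rightarrow> (nat \<Rightarrow> int \<Rightarrow> 'a \<Rightarrow> real) \<Rightarrow>
   int \<Rightarrow> int \<Rightarrow> 'a \<Rightarrow> real" where
  "xi_q p \<phi> q \<theta> t r \<omega> =
     xi p \<phi> t r \<omega> + (\<Sum>l = 1..q. xi p \<phi> t (r + int l) \<omega> * \<theta> l (r + int l) \<omega>)"

text \<open>
  Only arguments \<open>r \<le> s\<close> are meaningful, so that the lower summation bound \<open>s + 1 - r\<close> is a
  positive integer and \<open>nat\<close> does not truncate.
\<close>

definition xi_sq ::
  "nat \<Rightarrow> (nat \<Rightarrow> int \<Rightarrow> 'a \<Rightarrow> real) \<Rightarrow> int \<Rightarrow> nat \<Rightarrow> (nat \<Rightarrow> int \<Rightarrow> 'a \<Rightarrow> real) \<Rightarrow>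
   int \<Rightarrow> int \<Rightarrow> 'a \<Rightarrow> real" where
  "xi_sq p \<phi> s q \<theta> t r \<omega> =
     (\<Sum>l = nat (s + 1 - r)..q. xi p \<phi> t (r + int l) \<omega> * \<theta> l (r + int l) \<omega>)"

definition past_algebra :: "'a measure \<Rightarrow> (int \<Rightarrow> 'a \<Rightarrow> real) \<Rightarrow> int \<Rightarrow> 'a measure" where
  "past_algebra M y t =
     sigma (space M) {y s -` A \<inter> space M | s A. s < t \<and> A \<in> sets borel}"

text \<open>
  Equalities between random variables are understood almost surely. Square integrability is
  stated explicitly because the Bochner integral of a non-integrable function is 0.
\<close>

definition tv_errors ::
  "'a measure \<Rightarrow> (int \<Rightarrow> 'a \<Rightarrow> real) \<Rightarrow> (int \<Rightarrow> real) \<Rightarrow> (int \<Rightarrow> 'a \<Rightarrow> real) \<Rightarrow> bool" where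
  "tv_errors M \<epsilon> \<sigma> y \<longleftrightarrow>
     (\<forall>t. \<epsilon> t \<in> borel_measurable M) \<and>
     (\<forall>t. integrable M (\<lambda>\<omega>. (\<epsilon> t \<omega>)\<^sup>2)) \<and>
     (\<forall>t. integral\<^sup>L M (\<epsilon> t) = 0) \<and>
     (\<forall>s t. s \<noteq> t \<longrightarrow> integral\<^sup>L M (\<lambda>\<omega>. \<epsilon> t \<omega> * \<epsilon> s \<omega>) = 0) \<and>
     (\<forall>t. AE \<omega> in M. real_cond_exp M (past_algebra M y t) (\<epsilon> t) \<omega> = 0) \<and>
     (\<forall>t. integral\<^sup>L M (\<lambda>\<omega>. (\<epsilon> t \<omega>)\<^sup>2) = (\<sigma> t)\<^sup>2) \<and>
     (\<exists>B. \<forall>t. 0 < (\<sigma> t)\<^sup>2 \<and> (\<sigma> t)\<^sup>2 \<le> B)"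

definition ma_part ::
  "nat \<Rightarrow> (nat \<Rightarrow> int \<Rightarrow> 'a \<Rightarrow> real) \<Rightarrow> (int \<Rightarrow> 'a \<Rightarrow> real) \<Rightarrow> int \<Rightarrow> 'a \<Rightarrow> real" where
  "ma_part q \<theta> \<epsilon> t \<omega> = \<epsilon> t \<omega> + (\<Sum>l = 1..q. \<theta> l t \<omega> * \<epsilon> (t - int l) \<omega>)"

definition tv_arma_eq ::
  "'a measure \<Rightarrow> nat \<Rightarrow> (nat \<Rightarrow> int \<Rightarrow> 'a \<Rightarrow> real) \<Rightarrow> nat \<Rightarrow> (nat \<Rightarrow> int \<Rightarrow> 'a \<Rightarrow> real) \<Rightarrow>
   (int \<Rightarrow> 'a \<Rightarrow> real) \<Rightarrow> (int \<Rightarrow> 'a \<Rightarrow> real) \<Rightarrow> (int \<Rightarrow> 'a \<Rightarrow> real) \<Rightarrow> int \<Rightarrow> bool" where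
  "tv_arma_eq M p \<phi> q \<theta> drift \<epsilon> y t \<longleftrightarrow>
     (AE \<omega> in M. y t \<omega> =
        drift t \<omega> + (\<Sum>m = 1..p. \<phi> m t \<omega> * y (t - int m) \<omega>) + ma_part q \<theta> \<epsilon> t \<omega>)"

definition explicit_repr ::
  "'a measure \<Rightarrow> nat \<Rightarrow> (nat \<Rightarrow> int \<Rightarrow> 'a \<Rightarrow> real) \<Rightarrow> nat \<Rightarrow> (nat \<Rightarrow> int \<Rightarrow> 'a \<Rightarrow> real) \<Rightarrow>
   (int \<Rightarrow> 'a \<Rightarrow> real) \<Rightarrow> (int \<Rightarrow> 'a \<Rightarrow> real) \<Rightarrow> (int \<Rightarrow> 'a \<Rightarrow> real) \<Rightarrow> int \<Rightarrow> int \<Rightarrow> bool" where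
  "explicit_repr M p \<phi> q \<theta> drift \<epsilon> y s t \<longleftrightarrow>
     (AE \<omega> in M. y t \<omega> =
        (\<Sum>m = 1..p. xi_sup p \<phi> m t s \<omega> * y (s + 1 - int m) \<omega>)
        + (\<Sum>r = s + 1..t. xi p \<phi> t r \<omega> * drift r \<omega>)
        + (\<Sum>r = s + 1..t. xi_q p \<phi> q \<theta> t r \<omega> * \<epsilon> r \<omega>)
        + (\<Sum>r = s + 1 - int q..s. xi_sq p \<phi> s q \<theta> t r \<omega> * \<epsilon> r \<omega>))"

end

theory Submission
  imports Defs
begin

text \<open>
  Expanding along the last row, the principal determinant satisfies
  \<open>\<xi>(t,r) = (\<Sum>m=1..p. \<phi>\<^sub>m(t) \<xi>(t-m,r))\<close> for \<open>r < t\<close>, so together with \<open>\<xi>(t,t) = 1\<close> and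
  \<open>\<xi>(t,r) = 0\<close> for \<open>t < r\<close> it is the Green's function of the autoregressive recurrence. Moving
  the prescribed values \<open>y\<^sub>r\<close>, \<open>r \<le> s\<close>, into the forcing term \<open>g\<close>, the recurrence on \<open>t > s\<close> is
  equivalent to \<open>y\<^sub>t = (\<Sum>r=s+1..t. \<xi>(t,r) g(r))\<close>; collecting the coefficients of each \<open>y\<^sub>r\<close> and
  \<open>\<epsilon>\<^sub>r\<close> gives the stated form. All of this is pointwise in \<open>\<omega>\<close>; as there are only countably many
  times, one null set suffices.
\<close>

text \<open>The entries \<open>a\<close> do not depend on \<open>n\<close>, so for fixed
  \<open>a\<close> these matrices are leading principal blocks of one another.\<close>

definition hessenberg :: "nat \<Rightarrow> (nat \<Rightarrow> nat \<Rightarrow> 'a) \<Rightarrow> 'a::comm_ring_1 mat" where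
  "hessenberg n a = Matrix.mat n n (\<lambda>(i, j). if j \<le> i then a i j else if j = i + 1 then - 1 else 0)"

lemma hessenberg_carrier [simp]: "hessenberg n a \<in> carrier_mat n n"
  by (simp add: hessenberg_def)

text \<open>
  The last row is kept separate as \<open>v\<close> because expanding along the last column leaves a Hessenberg
  matrix of the next smaller size whose last row is again a prefix of \<open>v\<close>.
\<close>

lemma det_hessenberg_last_row:
  fixes a :: "nat \<Rightarrow> nat \<Rightarrow> 'a::comm_ring_1"
  shows "Determinant.det (hessenberg (Suc n) (a(n := v)))
    = (\<Sum>j\<le>n. v j * Determinant.det (hessenberg j a))"
proof (induction n)
  case 0
  show ?case
    by (simp add: det_single hessenberg_def)
next
  case (Suc n)
  let ?A = "hessenberg (Suc (Suc n)) (a(Suc n := v))"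
  have delete_last: "mat_delete ?A (Suc n) (Suc n) = hessenberg (Suc n) a"
    by (auto simp: hessenberg_def mat_delete_def intro!: eq_matI)
  have delete_previous: "mat_delete ?A n (Suc n) = hessenberg (Suc n) (a(n := v))"
    by (auto simp: hessenberg_def mat_delete_def intro!: eq_matI)
  have "Determinant.det ?A = (\<Sum>i<Suc (Suc n). ?A $$ (i, Suc n) * cofactor ?A i (Suc n))"
    by (rule laplace_expansion_column) simp_all
  \<comment> \<open>The last column is zero above its final two entries. The superdiagonal
    \<open>- 1\<close> cancels the negative sign of its cofactor, so both terms enter with a
    plus.\<close>
  also have "\<dots> = ?A $$ (n, Suc n) * cofactor ?A n (Suc n)
      + ?A $$ (Suc n, Suc n) * cofactor ?A (Suc n) (Suc n)"
    by (simp add: hessenberg_def)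
  also have "\<dots> = Determinant.det (hessenberg (Suc n) (a(n := v)))
      + v (Suc n) * Determinant.det (hessenberg (Suc n) a)"
    unfolding cofactor_def delete_last delete_previous by (simp add: hessenberg_def)
  finally show ?case
    by (simp add: Suc.IH del: fun_upd_apply)
qed

lemma xi_self [simp]: "xi p \<phi> t t \<omega> = 1"
  by (simp add: xi_def)

lemma xi_future [simp]: "t < s \<Longrightarrow> xi p \<phi> t s \<omega> = 0"
  by (simp add: xi_def)

lemma xi_recurrence:
  assumes "s < t" "p \<ge> 1"
  shows "xi p \<phi> t s \<omega> = (\<Sum>m = 1..p. \<phi> m t \<omega> * xi p \<phi> (t - int m) s \<omega>)"
proof -
  \<comment> \<open>Row \<open>i\<close> belongs to time \<open>s + i + 1\<close> whatever the end
    time, so for fixed \<open>s\<close> a single \<open>a\<close> serves all the matrices, and their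
    leading minors are again values of \<open>xi\<close> started at \<open>s\<close>.\<close>
  define a where
    "a i j = (if i - j \<le> p - 1 then \<phi> (i - j + 1) (s + int i + 1) \<omega> else 0)" for i j
  have Phi: "Phi_mat p \<phi> t' s \<omega> = hessenberg (nat (t' - s)) a" for t'
    by (auto simp: Phi_mat_def hessenberg_def a_def intro!: eq_matI)
  have det: "Determinant.det (hessenberg j a) = xi p \<phi> (s + int j) s \<omega>" for j
    by (cases "j = 0") (auto simp: xi_def Phi hessenberg_def)
  obtain n where n: "t = s + int (Suc n)"
    using zless_iff_Suc_zadd[of s t] assms(1) by auto
  have nonzero: "xi p \<phi> (t - int m) s \<omega> \<noteq> 0 \<Longrightarrow> m \<le> Suc n" for m
    using xi_future[of "t - int m" s] n by fastforce
  have "xi p \<phi> t s \<omega> = Determinant.det (hessenberg (Suc n) (a(n := a n)))"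
    using det[of "Suc n"] by (simp add: n)
  also have "\<dots> = (\<Sum>j\<le>n. a n j * xi p \<phi> (s + int j) s \<omega>)"
    by (simp only: det_hessenberg_last_row det)
  \<comment> \<open>The substitution \<open>m = Suc n - j\<close> turns the column index into the
    lag and the band limit into \<open>m \<le> p\<close>.\<close>
  also have "\<dots> = (\<Sum>m = 1..Suc n.
      if m \<le> p then \<phi> m t \<omega> * xi p \<phi> (t - int m) s \<omega> else 0)"
    by (rule sum.reindex_bij_witness[where i = "\<lambda>m. Suc n - m" and j = "\<lambda>j. Suc n - j"])
      (use assms(2) in \<open>auto simp: a_def n Suc_diff_le of_nat_diff ac_simps\<close>)
  also have "\<dots> = (\<Sum>m\<in>{m \<in> {1..Suc n}. m \<le> p}. \<phi> m t \<omega> * xi p \<phi> (t - int m) s \<omega>)"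
    by (rule sum.inter_filter[symmetric]) simp
  \<comment> \<open>If \<open>p > Suc n\<close>, the added lags reach back before \<open>s\<close>,
    where \<open>xi\<close> vanishes.\<close>
  also have "\<dots> = (\<Sum>m = 1..p. \<phi> m t \<omega> * xi p \<phi> (t - int m) s \<omega>)"
    by (rule sum.mono_neutral_left) (auto dest: nonzero)
  finally show ?thesis .
qed

text \<open>Cutting off lags that reach \<open>s\<close> or earlier imposes zero initial values, so
  superposing the responses \<open>X t r\<close> to impulses \<open>g r\<close> gives the only
  solution after \<open>s\<close>. As \<open>g\<close> is arbitrary, it can absorb the prescribed
  values.\<close>

lemma green_function_solution:
  fixes X :: "int \<Rightarrow> int \<Rightarrow> 'a::comm_ring_1" and c :: "nat \<Rightarrow> int \<Rightarrow> 'a"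
  assumes self: "\<And>t. X t t = 1"
    and future: "\<And>t r. t < r \<Longrightarrow> X t r = 0"
    and rec: "\<And>t r. r < t \<Longrightarrow> X t r = (\<Sum>m = 1..p. c m t * X (t - int m) r)"
  shows "(\<forall>t>s. z t = (\<Sum>m = 1..p. c m t * (if s < t - int m then z (t - int m) else 0)) + g t)
    \<longleftrightarrow> (\<forall>t>s. z t = (\<Sum>r = s + 1..t. X t r * g r))" (is "?L \<longleftrightarrow> ?R")
proof -
  define R where "R t = (\<Sum>r = s + 1..t. X t r * g r)" for t
  have R0: "R t = 0" if "t \<le> s" for t
    using that by (simp add: R_def)
  have R_rec: "R t = (\<Sum>m = 1..p. c m t * R (t - int m)) + g t" if "s < t" for t
  proof -
    \<comment> \<open>Padding with the zero terms \<open>r > t - m\<close> gives every lag the same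
      range, so that the two sums can be swapped.\<close>
    have extend: "(\<Sum>r = s + 1..t - 1. X (t - int m) r * g r) = R (t - int m)" if "1 \<le> m" for m
      unfolding R_def by (rule sum.mono_neutral_right) (use that future in auto)
    have "{s + 1..t} = insert t {s + 1..t - 1}"
      using that by auto
    then have "R t = g t + (\<Sum>r = s + 1..t - 1. X t r * g r)"
      by (simp add: R_def self)
    also have "(\<Sum>r = s + 1..t - 1. X t r * g r)
        = (\<Sum>r = s + 1..t - 1. \<Sum>m = 1..p. c m t * (X (t - int m) r * g r))"
      by (intro sum.cong refl) (simp add: rec sum_distrib_right mult.assoc)
    also have "\<dots> = (\<Sum>m = 1..p. c m t * (\<Sum>r = s + 1..t - 1. X (t - int m) r * g r))"
      by (subst sum.swap) (simp add: sum_distrib_left)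
    also have "\<dots> = (\<Sum>m = 1..p. c m t * R (t - int m))"
      by (intro sum.cong refl) (simp add: extend)
    finally show ?thesis
      by (simp add: add.commute)
  qed
  show ?thesis
  proof
    assume L: ?L
    have "z t = R t" if "s < t" for t
      using that
    proof (induction "nat (t - s)" arbitrary: t rule: less_induct)
      case less
      have "z t = (\<Sum>m = 1..p. c m t * (if s < t - int m then z (t - int m) else 0)) + g t"
        using L less.prems by blast
      also have "(\<Sum>m = 1..p. c m t * (if s < t - int m then z (t - int m) else 0))
          = (\<Sum>m = 1..p. c m t * R (t - int m))"
        by (intro sum.cong refl) (use less in \<open>auto simp: R0\<close>)
      finally show ?case
        using R_rec[OF less.prems] by simp
    qed
    then show ?R
      by (simp add: R_def)
  next
    assume "?R"
    then have z: "z t = R t" if "s < t" for t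
      using that by (simp add: R_def)
    have "(\<Sum>m = 1..p. c m t * (if s < t - int m then z (t - int m) else 0))
        = (\<Sum>m = 1..p. c m t * R (t - int m))" for t
      by (intro sum.cong refl) (auto simp: R0 z)
    then show ?L
      using z R_rec by simp
  qed
qed

text \<open>Each prescribed value acts through every later time whose lag reaches it; grouping these
  contributions by the value instead of by the time yields \<open>xi_sup\<close>.\<close>

lemma xi_sup_sum:
  "(\<Sum>m = 1..p. xi_sup p \<phi> m t s \<omega> * Y (s + 1 - int m))
    = (\<Sum>r = s + 1..t. xi p \<phi> t r \<omega> *
        (\<Sum>m = 1..p. if s < r - int m then 0 else \<phi> m r \<omega> * Y (r - int m)))"
proof -
  have "(\<Sum>m = 1..p. xi_sup p \<phi> m t s \<omega> * Y (s + 1 - int m))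
    = (\<Sum>(m, k)\<in>Sigma {1..p} (\<lambda>m. {1..p + 1 - m}).
        \<phi> (m - 1 + k) (s + int k) \<omega> * xi p \<phi> t (s + int k) \<omega> * Y (s + 1 - int m))"
    unfolding xi_sup_def sum_distrib_right by (rule sum.Sigma) auto
  also have "\<dots> = (\<Sum>(r, m)\<in>{s + 1..t} \<times> {1..p}.
      xi p \<phi> t r \<omega> * (if s < r - int m then 0 else \<phi> m r \<omega> * Y (r - int m)))"
    \<comment> \<open>Here \<open>k\<close> is the time elapsed since \<open>s\<close> and
      \<open>m - 1 + k\<close> the lag. \<open>S'\<close> collects times past \<open>t\<close>,
      where \<open>xi\<close> is 0, and \<open>T'\<close> lags landing after \<open>s\<close>, where
      the conditional is 0.\<close>
    by (rule sum.reindex_bij_witness_not_neutral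
          [where j = "\<lambda>(m, k). (s + int k, m - 1 + k)"
             and i = "\<lambda>(r, m). (m + 1 - nat (r - s), nat (r - s))"
             and S' = "{(m, k)\<in>Sigma {1..p} (\<lambda>m. {1..p + 1 - m}). t < s + int k}"
             and T' = "{(r, m)\<in>{s + 1..t} \<times> {1..p}. s < r - int m}"])
      (auto simp: of_nat_diff algebra_simps
        intro: finite_subset[of _ "Sigma {1..p} (\<lambda>m. {1..p + 1 - m})"]
          finite_subset[of _ "{s + 1..t} \<times> {1..p}"])
  finally show ?thesis
    by (simp add: sum_distrib_left sum.cartesian_product)
qed

text \<open>Regroup by the date of the error: one dated after \<open>s\<close> enters directly and
  through all its lags, an earlier one only through lags that carry it past
  \<open>s\<close>.\<close>

lemma xi_ma_part_sum:
  assumes "s < t"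
  shows "(\<Sum>r = s + 1..t. xi p \<phi> t r \<omega> * ma_part q \<theta> \<epsilon> r \<omega>)
    = (\<Sum>r = s + 1..t. xi_q p \<phi> q \<theta> t r \<omega> * \<epsilon> r \<omega>)
      + (\<Sum>r = s + 1 - int q..s. xi_sq p \<phi> s q \<theta> t r \<omega> * \<epsilon> r \<omega>)"
proof -
  let ?f = "\<lambda>r l. xi p \<phi> t (r + int l) \<omega> * \<theta> l (r + int l) \<omega> * \<epsilon> r \<omega>"
  let ?L = "\<lambda>r. if s < r then {1..q} else {nat (s + 1 - r)..q}"
  have "(\<Sum>r = s + 1..t. xi p \<phi> t r \<omega> * (\<Sum>l = 1..q. \<theta> l r \<omega> * \<epsilon> (r - int l) \<omega>))
      = (\<Sum>(r, l)\<in>{s + 1..t} \<times> {1..q}. xi p \<phi> t r \<omega> * (\<theta> l r \<omega> * \<epsilon> (r - int l) \<omega>))"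
    by (simp add: sum_distrib_left sum.cartesian_product)
  also have "\<dots> = (\<Sum>(r, l)\<in>Sigma {s + 1 - int q..t} ?L. ?f r l)"
    \<comment> \<open>The pairs in \<open>T'\<close> are carried past \<open>t\<close>, where
      \<open>xi\<close> is 0.\<close>
    by (rule sum.reindex_bij_witness_not_neutral
          [where j = "\<lambda>(r, l). (r - int l, l)"
             and i = "\<lambda>(r, l). (r + int l, l)"
             and S' = "{}"
             and T' = "{(r, l)\<in>Sigma {s + 1 - int q..t} ?L. t < r + int l}"])
      (auto split: if_splits intro: finite_subset[of _ "Sigma {s + 1 - int q..t} ?L"])
  also have "\<dots> = (\<Sum>r = s + 1 - int q..t. \<Sum>l\<in>?L r. ?f r l)"
    by (subst sum.Sigma) auto
  also have "{s + 1 - int q..t} = {s + 1..t} \<union> {s + 1 - int q..s}"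
    using assms by auto
  also have "(\<Sum>r\<in>{s + 1..t} \<union> {s + 1 - int q..s}. \<Sum>l\<in>?L r. ?f r l)
      = (\<Sum>r = s + 1..t. \<Sum>l = 1..q. ?f r l)
        + (\<Sum>r = s + 1 - int q..s. xi_sq p \<phi> s q \<theta> t r \<omega> * \<epsilon> r \<omega>)"
    by (subst sum.union_disjoint) (auto simp: xi_sq_def sum_distrib_right)
  finally show ?thesis
    by (simp add: ma_part_def xi_q_def distrib_left distrib_right sum.distrib sum_distrib_right)
qed

lemma arma_iff_explicit_pointwise:
  assumes "p \<ge> 1"
  shows "(\<forall>t>s. y t \<omega> = drift t \<omega> + (\<Sum>m = 1..p. \<phi> m t \<omega> * y (t - int m) \<omega>) + ma_part q \<theta> \<epsilon> t \<omega>)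
    \<longleftrightarrow> (\<forall>t>s. y t \<omega> =
        (\<Sum>m = 1..p. xi_sup p \<phi> m t s \<omega> * y (s + 1 - int m) \<omega>)
        + (\<Sum>r = s + 1..t. xi p \<phi> t r \<omega> * drift r \<omega>)
        + (\<Sum>r = s + 1..t. xi_q p \<phi> q \<theta> t r \<omega> * \<epsilon> r \<omega>)
        + (\<Sum>r = s + 1 - int q..s. xi_sq p \<phi> s q \<theta> t r \<omega> * \<epsilon> r \<omega>))"
    (is "(\<forall>t>s. ?arma t) \<longleftrightarrow> (\<forall>t>s. ?explicit t)")
proof -
  \<comment> \<open>The last sum holds exactly the lags that fall on values prescribed up to time
    \<open>s\<close>.\<close>
  define g where "g t = drift t \<omega> + ma_part q \<theta> \<epsilon> t \<omega>
    + (\<Sum>m = 1..p. if s < t - int m then 0 else \<phi> m t \<omega> * y (t - int m) \<omega>)" for t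
  have "(\<Sum>m = 1..p. \<phi> m t \<omega> * y (t - int m) \<omega>)
      = (\<Sum>m = 1..p. \<phi> m t \<omega> * (if s < t - int m then y (t - int m) \<omega> else 0))
        + (\<Sum>m = 1..p. if s < t - int m then 0 else \<phi> m t \<omega> * y (t - int m) \<omega>)" for t
    unfolding sum.distrib[symmetric] by (intro sum.cong) auto
  then have arma: "?arma t \<longleftrightarrow> y t \<omega> =
      (\<Sum>m = 1..p. \<phi> m t \<omega> * (if s < t - int m then y (t - int m) \<omega> else 0)) + g t" for t
    by (simp add: g_def algebra_simps)
  have explicit: "?explicit t \<longleftrightarrow> y t \<omega> = (\<Sum>r = s + 1..t. xi p \<phi> t r \<omega> * g r)"
    if "s < t" for t
  proof -
    have "(\<Sum>r = s + 1..t. xi p \<phi> t r \<omega> * g r)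
      = (\<Sum>r = s + 1..t. xi p \<phi> t r \<omega> *
          (\<Sum>m = 1..p. if s < r - int m then 0 else \<phi> m r \<omega> * y (r - int m) \<omega>))
        + (\<Sum>r = s + 1..t. xi p \<phi> t r \<omega> * drift r \<omega>)
        + (\<Sum>r = s + 1..t. xi p \<phi> t r \<omega> * ma_part q \<theta> \<epsilon> r \<omega>)"
      by (simp add: g_def distrib_left sum.distrib)
    then show ?thesis
      unfolding xi_sup_sum[where Y = "\<lambda>r. y r \<omega>"] xi_ma_part_sum[OF that]
      by (simp add: add.assoc)
  qed
  have "(\<forall>t>s. ?arma t) \<longleftrightarrow> (\<forall>t>s. y t \<omega> =
      (\<Sum>m = 1..p. \<phi> m t \<omega> * (if s < t - int m then y (t - int m) \<omega> else 0)) + g t)"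
    by (simp only: arma)
  also have "\<dots> \<longleftrightarrow> (\<forall>t>s. y t \<omega> = (\<Sum>r = s + 1..t. xi p \<phi> t r \<omega> * g r))"
    by (rule green_function_solution) (simp_all add: xi_recurrence[OF _ assms])
  also have "\<dots> \<longleftrightarrow> (\<forall>t>s. ?explicit t)"
    using explicit by blast
  finally show ?thesis .
qed

text \<open>The pointwise equivalence links whole families over \<open>t > s\<close>, not single
  times, so the quantifier over \<open>t\<close> must move inside the almost sure statement
  first.\<close>

lemma arma_iff_explicit_repr:
  assumes "p \<ge> 1"
  shows "(\<forall>t>s. tv_arma_eq M p \<phi> q \<theta> drift \<epsilon> y t)
    \<longleftrightarrow> (\<forall>t>s. explicit_repr M p \<phi> q \<theta> drift \<epsilon> y s t)"
proof -
  have AE_all: "(\<forall>t>s. AE \<omega> in M. P t \<omega>) \<longleftrightarrow> (AE \<omega> in M. \<forall>t>s. P t \<omega>)"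
    for P :: "int \<Rightarrow> 'a \<Rightarrow> bool"
    using AE_ball_countable[of "{s<..}" "\<lambda>\<omega> t. P t \<omega>" M] by (simp add: Ball_def)
  show ?thesis
    unfolding tv_arma_eq_def explicit_repr_def AE_all arma_iff_explicit_pointwise[OF assms] ..
qed

theorem theorem1:
  fixes M :: "'a measure"
    and p q :: nat
    and \<phi> \<theta> :: "nat \<Rightarrow> int \<Rightarrow> 'a \<Rightarrow> real"
    and drift \<epsilon> y :: "int \<Rightarrow> 'a \<Rightarrow> real"
    and \<sigma> :: "int \<Rightarrow> real"
  assumes "prob_space M"
    and "p \<ge> 1" and "q \<ge> 1"
    and "\<And>m t. 1 \<le> m \<Longrightarrow> m \<le> p \<Longrightarrow> \<phi> m t \<in> borel_measurable M"
    and "\<And>l t. 1 \<le> l \<Longrightarrow> l \<le> q \<Longrightarrow> \<theta> l t \<in> borel_measurable M"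
    and "\<And>t. drift t \<in> borel_measurable M"
    and "\<And>t. y t \<in> borel_measurable M"
    and "tv_errors M \<epsilon> \<sigma> y"
  shows "((\<forall>t. tv_arma_eq M p \<phi> q \<theta> drift \<epsilon> y t) \<longrightarrow>
            (\<forall>s t. s + 1 - int p \<le> t \<and> s < t \<longrightarrow>
               explicit_repr M p \<phi> q \<theta> drift \<epsilon> y s t))
       \<and> (\<forall>s. (\<forall>t. s < t \<longrightarrow> tv_arma_eq M p \<phi> q \<theta> drift \<epsilon> y t) \<longleftrightarrow>
            (\<forall>t. s + 1 - int p \<le> t \<and> s < t \<longrightarrow>
               explicit_repr M p \<phi> q \<theta> drift \<epsilon> y s t))"
proof -
  have "s + 1 - int p \<le> t \<and> s < t \<longleftrightarrow> s < t" for s t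
    using \<open>p \<ge> 1\<close> by auto
  then show ?thesis
    using arma_iff_explicit_repr[OF \<open>p \<ge> 1\<close>, of _ M \<phi> q \<theta> drift \<epsilon> y] by auto
qed

end
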